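(* Let $d\in\mathbb N$ and let $(c_n)_{n\ge 1}$ be a sequence of positive real numbers such that for some permutation $(c'_n)$ of $(c_n)$ the sequence $(\sqrt[d]{n}/c'_n)_{n\ge1}$ is bounded. Moreover, let $f:\mathbb R^d\to\mathbb R$ be measurable and such that for every $\varepsilon>0$ one has $\lambda(\{x\in\mathbb R^d:|f(x)|\geq\varepsilon\})<\infty$. Then for $\lambda$-almost every $x\in\mathbb R^d$ one has $f(c_nx)\to0$ as $n\to\infty$.
   Context: $\mathbb N=\{1,2,3,\dots\}$ and $\lambda$ is the $d$-dimensional Lebesgue measure on $\mathbb R^d$; measurable means Lebesgue measurable. A permutation of a sequence $(c_n)_{n\ge1}$ is a sequence $(c'_n)_{n\ge1}$ of the form $c'_n=c_{\sigma(n)}$ for a bijection $\sigma:\mathbb N\to\mathbb N$. *)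

theory Defs
  imports "HOL-Analysis.Analysis"
begin

end

theory Submission
  imports Defs
begin

text \<open>
  Fix \<open>\<epsilon> > 0\<close> and put \<open>E = {x. \<bar>f x\<bar> \<ge> \<epsilon>}\<close>, a set of finite measure. It has to be shown that for almost
  every \<open>x\<close> only finitely many of the points \<open>c\<^sub>n x\<close> lie in \<open>E\<close>. A direct Borel--Cantelli argument just
  fails: the set \<open>{x. c\<^sub>n x \<in> E}\<close> has measure \<open>c\<^sub>n\<^sup>-\<^sup>d \<lambda>(E)\<close>, and the hypothesis only makes \<open>c\<^sub>n\<^sup>-\<^sup>d\<close>, suitably
  reordered, of order \<open>1/n\<close>.

  The remedy is to restrict \<open>x\<close> to an annulus \<open>r \<le> \<bar>x\<bar> \<le> R\<close>. Substituting \<open>y = c\<^sub>n x\<close> and exchanging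
  sum and integral, the measures of the sets \<open>{x. r \<le> \<bar>x\<bar> \<le> R, c\<^sub>n x \<in> E}\<close> add up to the integral over
  \<open>y \<in> E\<close> of the sum of \<open>c\<^sub>n\<^sup>-\<^sup>d\<close> over those \<open>n\<close> with \<open>\<bar>y\<bar>/R \<le> c\<^sub>n \<le> \<bar>y\<bar>/r\<close>. The hypothesis on \<open>c\<close> is used
  only through the bound \<open>#{n. c\<^sub>n \<le> t} \<le> (B t)\<^sup>d\<close> (lemma \<open>card_le_of_rearranged_root_growth\<close>),
  which does not see the order of the sequence. It gives at most \<open>(B \<bar>y\<bar>/r)\<^sup>d\<close> such \<open>n\<close>, each
  contributing at most \<open>(R/\<bar>y\<bar>)\<^sup>d\<close>, so the integrand is at most \<open>(B R/r)\<^sup>d\<close> whatever \<open>y\<close> is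
  (lemma \<open>sum_inverse_powers_in_window_le\<close>). Hence the series of measures converges and the
  Borel--Cantelli lemma applies on the annulus. Countably many annuli cover everything but the origin,
  and countably many \<open>\<epsilon>\<close> suffice for convergence to \<open>0\<close>.
\<close>

text \<open>
  If the \<open>m\<close>-th term of some rearrangement is at most \<open>t\<close>, then \<open>root d m \<le> B t\<close>; so the positions
  of all such terms in the rearrangement lie in an initial segment of length \<open>(B t)\<^sup>d\<close>.
\<close>
lemma card_le_of_rearranged_root_growth:
  fixes c :: "nat \<Rightarrow> real"
  assumes pos: "\<And>n. n \<ge> 1 \<Longrightarrow> c n > 0"
    and bij: "bij_betw \<sigma> {1::nat..} {1..}"
    and bound: "\<And>n. n \<ge> 1 \<Longrightarrow> root d (real n) / c (\<sigma> n) \<le> B"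
    and d: "d > 0" and B: "B > 0" and t: "t > 0"
  shows "finite {n \<in> {1..}. c n \<le> t} \<and> real (card {n \<in> {1..}. c n \<le> t}) \<le> (B * t) ^ d"
proof -
  let ?k = "nat \<lfloor>(B * t) ^ d\<rfloor>"
  have "{n \<in> {1..}. c n \<le> t} \<subseteq> \<sigma> ` {1..?k}"
  proof
    fix n assume n: "n \<in> {n \<in> {1..}. c n \<le> t}"
    then obtain m where m: "m \<ge> 1" "n = \<sigma> m"
      using bij by (auto simp: bij_betw_def)
    have cpos: "c n > 0" using n pos by simp
    have "root d (real m) \<le> B * c n"
      using bound[OF m(1)] cpos by (simp add: m(2) divide_simps)
    also have "\<dots> \<le> B * t" using n B by simp
    finally have "root d (real m) ^ d \<le> (B * t) ^ d"
      by (intro power_mono) (simp_all add: real_root_ge_zero)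
    then have "real m \<le> (B * t) ^ d" using d by simp
    then have "m \<le> ?k" by linarith
    then show "n \<in> \<sigma> ` {1..?k}" using m by auto
  qed
  then have fin: "finite {n \<in> {1..}. c n \<le> t}"
    and card: "card {n \<in> {1..}. c n \<le> t} \<le> card (\<sigma> ` {1..?k})"
    by (auto intro: finite_subset card_mono)
  have "card (\<sigma> ` {1..?k}) \<le> ?k"
    using card_image_le[of "{1..?k}" \<sigma>] by simp
  with card have "real (card {n \<in> {1..}. c n \<le> t}) \<le> real ?k" by linarith
  also have "\<dots> \<le> (B * t) ^ d" using B t by (simp add: zero_le_power)
  finally show ?thesis using fin by simp
qed

text \<open>
  The estimate that replaces the divergent \<open>\<Sum> 1/n\<close>: for terms confined to a window of bounded ratio
  \<open>R/r\<close>, the number of terms and their size balance, and the position \<open>s\<close> of the window cancels.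
\<close>
lemma sum_inverse_powers_in_window_le:
  fixes a :: "nat \<Rightarrow> real"
  assumes pos: "\<And>n. a n > 0"
    and count: "\<And>t. t > 0 \<Longrightarrow> finite {n. a n \<le> t} \<and> real (card {n. a n \<le> t}) \<le> (B * t) ^ d"
    and r: "0 < r" and R: "0 < R" and s: "s > 0"
    and J: "\<And>n. n \<in> J \<Longrightarrow> r * a n \<le> s \<and> s \<le> R * a n"
  shows "(\<Sum>n\<in>J. (1 / a n) ^ d) \<le> (B * R / r) ^ d"
proof -
  have J_sub: "J \<subseteq> {n. a n \<le> s / r}"
    using J r by (auto simp: field_simps)
  have "(1 / a n) ^ d \<le> (R / s) ^ d" if "n \<in> J" for n
    using J[OF that] s pos[of n] by (intro power_mono) (auto simp: field_simps)
  then have "(\<Sum>n\<in>J. (1 / a n) ^ d) \<le> real (card J) * (R / s) ^ d"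
    by (rule sum_bounded_above)
  also have "\<dots> \<le> (B * (s / r)) ^ d * (R / s) ^ d"
  proof (rule mult_right_mono)
    have "card J \<le> card {n. a n \<le> s / r}"
      using count[of "s / r"] r s J_sub by (intro card_mono) auto
    then show "real (card J) \<le> (B * (s / r)) ^ d"
      using count[of "s / r"] r s by fastforce
  qed (use R s in simp)
  also have "\<dots> = (B * R / r) ^ d"
    unfolding power_mult_distrib[symmetric] using s r by (simp add: mult.commute)
  finally show ?thesis .
qed

lemma vimage_scaleR_eq_image:
  fixes S :: "'a::real_vector set"
  assumes "a \<noteq> 0"
  shows "{x. a *\<^sub>R x \<in> S} = (\<lambda>y. (1 / a) *\<^sub>R y + 0) ` S"
proof -
  have "x \<in> (\<lambda>y. (1 / a) *\<^sub>R y + 0) ` S" if "a *\<^sub>R x \<in> S" for x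
    using that assms by (intro image_eqI[of _ _ "a *\<^sub>R x"]) auto
  then show ?thesis using assms by auto
qed

text \<open>
  On the annulus, \<open>a n *\<^sub>R x \<in> E\<close> forces \<open>a n *\<^sub>R x\<close> into the part \<open>T n\<close> of \<open>E\<close> between the radii
  \<open>r * a n\<close> and \<open>R * a n\<close>. A fixed \<open>y\<close> lies in \<open>T n\<close> only if \<open>a n\<close> falls into the window between \<open>norm y / R\<close>
  and \<open>norm y / r\<close>, so the weighted indicators of the sets \<open>T n\<close> have a bounded sum, and integrating
  that sum over \<open>E\<close> bounds the partial sums of the measures of the scaled-back sets \<open>S n\<close>.
\<close>
lemma AE_dilates_eventually_avoid_on_annulus:
  fixes E :: "'a::euclidean_space set" and a :: "nat \<Rightarrow> real"
  assumes pos: "\<And>n. a n > 0"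
    and count: "\<And>t. t > 0 \<Longrightarrow>
      finite {n. a n \<le> t} \<and> real (card {n. a n \<le> t}) \<le> (B * t) ^ DIM('a)"
    and B: "0 \<le> B" and E: "E \<in> lmeasurable"
    and r: "0 < r" and R: "0 < R"
  shows "AE x in lebesgue. r \<le> norm x \<and> norm x \<le> R \<longrightarrow> (\<forall>\<^sub>F n in sequentially. a n *\<^sub>R x \<notin> E)"
proof -
  define T where "T n = E \<inter> {y. r * a n \<le> norm y \<and> norm y \<le> R * a n}" for n
  define S where "S n = {x. a n *\<^sub>R x \<in> T n}" for n
  have "closed {y::'a. r * a n \<le> norm y \<and> norm y \<le> R * a n}" for n
    by (intro closed_Collect_conj closed_Collect_le continuous_intros)
  then have T: "T n \<in> lmeasurable" for n
    unfolding T_def using E by (intro fmeasurable_Int_fmeasurable) auto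
  have S_image: "S n = (\<lambda>y. (1 / a n) *\<^sub>R y + 0) ` T n" for n
    unfolding S_def using pos[of n] by (intro vimage_scaleR_eq_image) simp
  have S_meas: "S n \<in> sets lebesgue" for n
  proof -
    have "(*\<^sub>R) (a n) -` T n \<inter> space lebesgue \<in> sets lebesgue"
      using T by (intro measurable_sets[OF lebesgue_measurable_scaling]) auto
    then show ?thesis by (simp add: S_def vimage_def)
  qed
  have S_measure: "measure lebesgue (S n) = (1 / a n) ^ DIM('a) * measure lebesgue (T n)" for n
    unfolding S_image measure_lebesgue_affine using pos[of n] by simp
  have S_emeasure: "emeasure lebesgue (S n) < \<infinity>" for n
  proof -
    have "emeasure lebesgue (T n) < \<infinity>" using T[of n] by (auto simp: fmeasurable_def)
    moreover have "ennreal (\<bar>1 / a n\<bar> ^ DIM('a)) < \<infinity>" by simp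
    ultimately show ?thesis
      unfolding S_image emeasure_lebesgue_affine infinity_ennreal_def ennreal_mult_less_top
      by blast
  qed
  have "(\<Sum>n<N. measure lebesgue (S n)) \<le> (B * R / r) ^ DIM('a) * measure lebesgue E" for N
  proof -
    let ?g = "\<lambda>y. \<Sum>n<N. (1 / a n) ^ DIM('a) * indicat_real (T n) y"
    have int_T: "integrable lebesgue (indicat_real (T n))" for n
      using fmeasurableD[OF T] fmeasurableD2[OF T[of n]]
      by (intro integrable_real_indicator) (auto simp: top.not_eq_extremum)
    have int_E: "integrable lebesgue (indicat_real E)"
      using fmeasurableD[OF E] fmeasurableD2[OF E]
      by (intro integrable_real_indicator) (auto simp: top.not_eq_extremum)
    have int_g: "integrable lebesgue ?g"
      by (intro Bochner_Integration.integrable_sum integrable_mult_right int_T)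
    have "?g y \<le> (B * R / r) ^ DIM('a) * indicat_real E y" for y
    proof (cases "y \<in> E \<and> y \<noteq> 0")
      case True
      have "?g y = (\<Sum>n\<in>{n \<in> {..<N}. y \<in> T n}. (1 / a n) ^ DIM('a))"
        unfolding sum.inter_filter[OF finite_lessThan]
        by (intro sum.cong) (auto simp: indicator_def)
      also have "\<dots> \<le> (B * R / r) ^ DIM('a)"
        using True pos count r R by (intro sum_inverse_powers_in_window_le[where s = "norm y"])
          (auto simp: T_def)
      finally show ?thesis using True by simp
    next
      case False
      \<comment> \<open>At the origin all terms vanish, since the lower radius \<open>r * a n\<close> is positive.\<close>
      then have "y \<notin> T n" for n
        using mult_pos_pos[OF r pos[of n]] by (auto simp: T_def)
      moreover have "0 \<le> (B * R / r) ^ DIM('a)"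
        using B r R by simp
      ultimately show ?thesis by simp
    qed
    then have "integral\<^sup>L lebesgue ?g \<le> (\<integral>y. (B * R / r) ^ DIM('a) * indicat_real E y \<partial>lebesgue)"
      by (intro integral_mono int_g integrable_mult_right int_E)
    moreover have "integral\<^sup>L lebesgue ?g = (\<Sum>n<N. measure lebesgue (S n))"
    proof -
      have "integral\<^sup>L lebesgue ?g =
          (\<Sum>n<N. \<integral>y. (1 / a n) ^ DIM('a) * indicat_real (T n) y \<partial>lebesgue)"
        by (intro Bochner_Integration.integral_sum integrable_mult_right int_T)
      also have "\<dots> = (\<Sum>n<N. measure lebesgue (S n))"
        by (intro sum.cong) (simp_all add: S_measure)
      finally show ?thesis .
    qed
    ultimately show ?thesis by simp
  qed
  then have "summable (\<lambda>n. measure lebesgue (S n))"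
    by (rule summableI_nonneg_bounded[OF measure_nonneg])
  from borel_cantelli_AE1[OF S_meas S_emeasure this] show ?thesis
  proof (rule AE_mp, intro AE_I2 impI)
    fix x :: 'a
    assume ev: "\<forall>\<^sub>F n in sequentially. x \<in> space lebesgue - S n" and x: "r \<le> norm x \<and> norm x \<le> R"
    have in_S: "x \<in> S n" if "a n *\<^sub>R x \<in> E" for n
      using that x pos[of n] by (auto simp: S_def T_def mult.commute)
    from ev show "\<forall>\<^sub>F n in sequentially. a n *\<^sub>R x \<notin> E"
      by (rule eventually_mono) (use in_S in blast)
  qed
qed

text \<open>
  The annuli of radii \<open>1/(k+1)\<close> and \<open>k+1\<close> exhaust the complement of the origin, a null set.
\<close>
lemma AE_dilates_eventually_avoid:
  fixes E :: "'a::euclidean_space set" and a :: "nat \<Rightarrow> real"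
  assumes pos: "\<And>n. a n > 0"
    and count: "\<And>t. t > 0 \<Longrightarrow>
      finite {n. a n \<le> t} \<and> real (card {n. a n \<le> t}) \<le> (B * t) ^ DIM('a)"
    and B: "0 \<le> B" and E: "E \<in> lmeasurable"
  shows "AE x in lebesgue. \<forall>\<^sub>F n in sequentially. a n *\<^sub>R x \<notin> E"
proof -
  have "AE x in lebesgue. \<forall>k. 1 / real (Suc k) \<le> norm x \<and> norm x \<le> real (Suc k) \<longrightarrow>
      (\<forall>\<^sub>F n in sequentially. a n *\<^sub>R x \<notin> E)"
    unfolding AE_all_countable
    by (intro allI AE_dilates_eventually_avoid_on_annulus[OF pos count B E]) auto
  moreover have "AE x in lebesgue. x \<noteq> (0::'a)"
    by (rule AE_I'[of "{0}"]) auto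
  ultimately show ?thesis
  proof eventually_elim
    case (elim x)
    obtain i where i: "norm x \<le> real i" using real_arch_simple by blast
    obtain j where j: "1 / real (Suc j) < norm x"
      using elim(2) nat_approx_posE[of "norm x"] by auto
    define k where "k = max i j"
    have "1 / real (Suc k) \<le> 1 / real (Suc j)" by (simp add: k_def frac_le)
    then have "1 / real (Suc k) \<le> norm x \<and> norm x \<le> real (Suc k)"
      using i j by (simp add: k_def)
    with elim(1) show ?case by blast
  qed
qed

theorem theorem2:
  fixes c :: "nat \<Rightarrow> real"
    and f :: "real ^ 'd \<Rightarrow> real"
  assumes c_pos: "\<And>n. n \<ge> 1 \<Longrightarrow> c n > 0"
    and perm: "\<exists>\<sigma>. bij_betw \<sigma> {1::nat..} {1::nat..} \<and>
      bounded ((\<lambda>n. root CARD('d) (real n) / c (\<sigma> n)) ` {1..})"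
    and f_meas: "f \<in> borel_measurable lebesgue"
    and f_fin: "\<And>\<epsilon>. \<epsilon> > 0 \<Longrightarrow> emeasure lebesgue {x. \<bar>f x\<bar> \<ge> \<epsilon>} < \<infinity>"
  shows "AE x in lebesgue. (\<lambda>n. f (c n *\<^sub>R x)) \<longlonglongrightarrow> 0"
proof -
  obtain \<sigma> where bij: "bij_betw \<sigma> {1::nat..} {1::nat..}"
    and bdd: "bounded ((\<lambda>n. root CARD('d) (real n) / c (\<sigma> n)) ` {1..})"
    using perm by blast
  obtain B where B: "B > 0"
    and "\<forall>u \<in> (\<lambda>n. root CARD('d) (real n) / c (\<sigma> n)) ` {1..}. norm u \<le> B"
    using bdd unfolding bounded_pos by blast
  then have bound: "root CARD('d) (real n) / c (\<sigma> n) \<le> B" if "n \<ge> 1" for n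
    using that by (force simp: abs_le_iff)
  \<comment> \<open>The term \<open>c 0\<close> may be nonpositive; the shifted sequence is positive throughout.\<close>
  define a where "a n = c (Suc n)" for n
  have a_pos: "a n > 0" for n using c_pos by (simp add: a_def)
  have count: "finite {n. a n \<le> t} \<and> real (card {n. a n \<le> t}) \<le> (B * t) ^ DIM(real ^ 'd)"
    if "t > 0" for t
  proof -
    have bij_Suc: "bij_betw Suc {n. a n \<le> t} {n \<in> {1..}. c n \<le> t}"
      by (rule bij_betw_byWitness[where f' = "\<lambda>n. n - 1"]) (auto simp: a_def)
    show ?thesis
      using card_le_of_rearranged_root_growth[OF c_pos bij bound _ B that]
        bij_betw_same_card[OF bij_Suc] bij_betw_finite[OF bij_Suc] by simp
  qed
  have "AE x in lebesgue. \<forall>k. \<forall>\<^sub>F n in sequentially. a n *\<^sub>R x \<notin> {y. \<bar>f y\<bar> \<ge> 1 / real (Suc k)}"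
    unfolding AE_all_countable
  proof
    fix k
    have "{y \<in> space lebesgue. \<bar>f y\<bar> \<ge> 1 / real (Suc k)} \<in> sets lebesgue"
      using f_meas by measurable
    then have E: "{y. \<bar>f y\<bar> \<ge> 1 / real (Suc k)} \<in> lmeasurable"
      using f_fin[of "1 / real (Suc k)"] by (simp add: fmeasurable_def)
    show "AE x in lebesgue. \<forall>\<^sub>F n in sequentially.
        a n *\<^sub>R x \<notin> {y. \<bar>f y\<bar> \<ge> 1 / real (Suc k)}"
      by (rule AE_dilates_eventually_avoid[OF a_pos count less_imp_le[OF B] E])
  qed
  then show ?thesis
  proof eventually_elim
    case (elim x)
    have "(\<lambda>n. f (a n *\<^sub>R x)) \<longlonglongrightarrow> 0"
    proof (rule tendstoI)
      fix e :: real assume "e > 0"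
      then obtain k where k: "1 / real (Suc k) < e" using nat_approx_posE by blast
      have "\<forall>\<^sub>F n in sequentially. \<not> \<bar>f (a n *\<^sub>R x)\<bar> \<ge> 1 / real (Suc k)"
        using elim by simp
      then show "\<forall>\<^sub>F n in sequentially. dist (f (a n *\<^sub>R x)) 0 < e"
        by eventually_elim (use k in \<open>simp add: dist_real_def\<close>)
    qed
    then show ?case
      unfolding a_def by (rule filterlim_sequentially_Suc[THEN iffD1])
  qed
qed

end
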